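(* Let $p$ be a prime and let $r \in 1 + p\mathbb{Z}$. Then the function $\overline{\gamma}_r : \mathbb{Z}_p \to \mathbb{C}_p$, $\overline{\gamma}_r(x) = \exp(r\tilde{p})\,\gamma_r(x-1)$, is locally analytic and satisfies $$\overline{\gamma}_r(n) = \tau_p(\Gamma(n,r)) \quad\text{for all integers } n \ge 1 .$$
   Context: $C(\mathbb{Z}_p,\mathbb{C}_p)$ is the space of continuous functions $\mathbb{Z}_p \to \mathbb{C}_p$, and $\mathscr{S}$ is the $\mathbb{C}_p$-linear automorphism of $C(\mathbb{Z}_p,\mathbb{C}_p)$ given by $\mathscr{S}(\phi)(x) = \phi(x) - x\phi(x-1)$. For $r \in \mathbb{C}_p$ with $|r-1|<1$, $g_r : \mathbb{Z}_p \to \mathbb{C}_p$ is $g_r(x) = r^x = \sum_{n\ge0}(r-1)^n\binom{x}{n}$, and $\gamma_r = \mathscr{S}^{-1}(g_r)$. Here $\tilde{p} = p$ if $p$ is odd and $\tilde{p} = 4$ if $p = 2$, and $\exp$ is the $p$-adic exponential series. $\Gamma(n,r) = \int_r^\infty x^{n-1}e^{-x}\,dx$ is the classical (complex) incomplete Gamma function, which lies in $\mathbb{Q}(e)$ for $n \in \mathbb{Z}_{\ge1}$ and $r \in \mathbb{Z}$, and $\tau_p : \mathbb{Q}(e) \to \mathbb{Q}_p$ is the unique field homomorphism sending $e^{-1}$ to $\exp(\tilde{p})$. A function $f : \mathbb{Z}_p \to \mathbb{C}_p$ is locally analytic if every $x_0 \in \mathbb{Z}_p$ has a neighbourhood in $\mathbb{Z}_p$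 on which $f$ is given by a convergent power series in $x - x_0$ with coefficients in $\mathbb{C}_p$. *)

theory Defs
  imports "HOL-Analysis.Analysis" "HOL-Computational_Algebra.Computational_Algebra"
    "HOL-Number_Theory.Cong"
begin

text \<open>
  There is no type of \<open>p\<close>-adic complex numbers in the libraries, and a type cannot depend on the
  number \<open>p\<close>. So \<open>\<complex>\<^sub>p\<close> is an arbitrary type \<open>'a\<close> that is a completion of an algebraic closure of
  \<open>\<rat>\<^sub>p\<close> (predicate \<open>is_Cp\<close> below), which determines it up to isometric isomorphism. The metric of the
  type is the one of the absolute value, so that \<open>sums\<close>, \<open>suminf\<close>, \<open>continuous_on\<close> and \<open>closure\<close>
  all refer to the \<open>p\<close>-adic topology. \<open>\<rat>\<^sub>p\<close> and \<open>\<int>\<^sub>p\<close> are subsets of \<open>'a\<close>.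
\<close>

definition vabs :: "'a :: {field_char_0, metric_space} \<Rightarrow> real" where
  "vabs x = dist x 0"

definition Qp :: "'a :: {field_char_0, metric_space} set" where
  "Qp = closure \<rat>"

definition Zp :: "'a :: {field_char_0, metric_space} set" where
  "Zp = {x \<in> Qp. vabs x \<le> 1}"

definition Qp_alg :: "'a :: {field_char_0, metric_space} set" where
  "Qp_alg = {x. \<exists>P. P \<noteq> 0 \<and> (\<forall>i. coeff P i \<in> Qp) \<and> poly P x = 0}"

text \<open>
  The class \<open>complete_space\<close> supplies completeness, so \<open>Qp\<close> is a completion of \<open>\<rat>\<close> for the
  \<open>p\<close>-adic absolute value. The last two conditions say that \<open>Qp_alg\<close> is an algebraic closure of
  \<open>Qp\<close> and that \<open>'a\<close> is its completion.
\<close>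

definition is_Cp :: "nat \<Rightarrow> 'a :: {field_char_0, complete_space} itself \<Rightarrow> bool" where
  "is_Cp p T \<longleftrightarrow>
     (\<forall>x y :: 'a. dist x y = vabs (x - y)) \<and>
     (\<forall>x y :: 'a. vabs (x * y) = vabs x * vabs y) \<and>
     (\<forall>x y :: 'a. vabs (x + y) \<le> max (vabs x) (vabs y)) \<and>
     (\<forall>m :: int. m \<noteq> 0 \<longrightarrow> vabs (of_int m :: 'a) = 1 / real p ^ multiplicity (int p) m) \<and>
     (\<forall>P :: 'a poly. degree P > 0 \<longrightarrow> (\<forall>i. coeff P i \<in> Qp_alg) \<longrightarrow> (\<exists>x\<in>Qp_alg. poly P x = 0)) \<and>
     closure (Qp_alg :: 'a set) = UNIV"

text \<open>Functions on \<open>\<int>\<^sub>p\<close> are represented by extensional functions, which makes equality of functions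
  on \<open>\<int>\<^sub>p\<close> coincide with equality in HOL.\<close>

definition C_Zp :: "('a :: {field_char_0, metric_space} \<Rightarrow> 'a) set" where
  "C_Zp = {\<phi> \<in> extensional Zp. continuous_on Zp \<phi>}"

definition S_op :: "('a :: {field_char_0, metric_space} \<Rightarrow> 'a) \<Rightarrow> 'a \<Rightarrow> 'a" where
  "S_op \<phi> = (\<lambda>x\<in>Zp. \<phi> x - x * \<phi> (x - 1))"

definition g_fun :: "'a :: {field_char_0, metric_space} \<Rightarrow> 'a \<Rightarrow> 'a" where
  "g_fun r = (\<lambda>x\<in>Zp. \<Sum>n. (r - 1) ^ n * (x gchoose n))"

definition \<gamma>_fun :: "'a :: {field_char_0, metric_space} \<Rightarrow> 'a \<Rightarrow> 'a" where
  "\<gamma>_fun r = inv_into C_Zp S_op (g_fun r)"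

definition p_tilde :: "nat \<Rightarrow> nat" where
  "p_tilde p = (if p = 2 then 4 else p)"

definition padic_exp :: "'a :: {field_char_0, metric_space} \<Rightarrow> 'a" where
  "padic_exp x = (\<Sum>n. x ^ n / fact n)"

definition \<gamma>_bar :: "nat \<Rightarrow> 'a :: {field_char_0, metric_space} \<Rightarrow> 'a \<Rightarrow> 'a" where
  "\<gamma>_bar p r = (\<lambda>x\<in>Zp. padic_exp (r * of_nat (p_tilde p)) * \<gamma>_fun r (x - 1))"

definition locally_analytic :: "('a :: {field_char_0, metric_space} \<Rightarrow> 'a) \<Rightarrow> bool" where
  "locally_analytic f \<longleftrightarrow>
     (\<forall>x0\<in>Zp. \<exists>U a. open U \<and> x0 \<in> U \<and> (\<forall>x\<in>U \<inter> Zp. (\<lambda>n. a n * (x - x0) ^ n) sums f x))"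

definition inc_Gamma :: "nat \<Rightarrow> real \<Rightarrow> real" where
  "inc_Gamma n r = integral {r..} (\<lambda>x. x ^ (n - 1) * exp (- x))"

definition is_subfield :: "'b :: field set \<Rightarrow> bool" where
  "is_subfield K \<longleftrightarrow>
     1 \<in> K \<and> (\<forall>x\<in>K. \<forall>y\<in>K. x - y \<in> K \<and> x * y \<in> K) \<and> (\<forall>x\<in>K. inverse x \<in> K)"

definition Q_e :: "real set" where
  "Q_e = \<Inter>{K. is_subfield K \<and> exp 1 \<in> K}"

text \<open>Only the values of \<open>\<tau>\<close> on \<open>\<rat>(e)\<close> are constrained.\<close>

definition is_\<tau> :: "nat \<Rightarrow> (real \<Rightarrow> 'a :: {field_char_0, metric_space}) \<Rightarrow> bool" where
  "is_\<tau> p \<tau> \<longleftrightarrow>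
     \<tau> ` Q_e \<subseteq> Qp \<and> \<tau> 1 = 1 \<and>
     (\<forall>x\<in>Q_e. \<forall>y\<in>Q_e. \<tau> (x + y) = \<tau> x + \<tau> y \<and> \<tau> (x * y) = \<tau> x * \<tau> y) \<and>
     \<tau> (exp (- 1)) = padic_exp (of_nat (p_tilde p))"

end

theory Submission imports Defs begin

text \<open>
  Write \<open>(x)\<^sub>n = x (x - 1) \<cdots> (x - n + 1)\<close> and \<open>c\<^sub>n = \<Sum>\<^bsub>k \<le> n\<^esub> (r - 1)\<^sup>k / k!\<close>. Because
  \<open>x (x - 1)\<^sub>n = (x)\<^sub>n\<^sub>+\<^sub>1\<close>, the series \<open>\<Sum> c\<^sub>n (x)\<^sub>n\<close> solves the equation that defines \<open>\<gamma>\<^sub>r\<close>,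
  and \<open>\<bar>c\<^sub>n\<bar> \<le> 1\<close> because \<open>\<bar>r - 1\<bar> \<le> 1 / p\<close>. Among \<open>p\<close> consecutive factors of \<open>(x\<^sub>0 + y)\<^sub>n\<close> one has
  Gauss norm at most \<open>1 / p\<close> on the disc \<open>\<bar>y\<bar> \<le> 1 / p\<close> and the others at most \<open>1\<close>, so the series
  converges in the Gauss norm on this disc, which gives local analyticity. At integers both
  \<open>\<gamma>\<^sub>r(n)\<close> and \<open>e\<^sup>r \<Gamma>(n + 1, r)\<close> satisfy \<open>G(0) = 1\<close>, \<open>G(n) = n G(n - 1) + r\<^sup>n\<close>.
\<close>

section \<open>The incomplete Gamma function at integers\<close>

text \<open>In closed form this is the sum of \<open>n! / k! * x ^ k\<close> over
  \<open>k \<le> n\<close>. It is polymorphic so that one polynomial can be evaluated at a real, an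
  integer and a p-adic argument.\<close>

primrec gamma_poly :: "nat \<Rightarrow> 'a :: comm_ring_1 \<Rightarrow> 'a" where
  "gamma_poly 0 x = 1"
| "gamma_poly (Suc n) x = of_nat (Suc n) * gamma_poly n x + x ^ Suc n"

lemma of_int_gamma_poly: "of_int (gamma_poly n x) = gamma_poly n (of_int x)"
  by (induction n) simp_all

text \<open>Differentiating \<open>n! / k! * x ^ k\<close> gives the term with index
  \<open>k - 1\<close>, so only the top term \<open>x ^ n\<close> is lost. Hence
  \<open>- exp (- x) * gamma_poly n x\<close> is an antiderivative of
  \<open>x ^ n * exp (- x)\<close>.\<close>

lemma gamma_poly_has_real_derivative:
  "(gamma_poly n has_real_derivative gamma_poly n x - x ^ n) (at x)"
proof (induction n)
  case 0
  have "(gamma_poly 0 :: real \<Rightarrow> real) = (\<lambda>_. 1)"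
    by auto
  then show ?case by simp
next
  case (Suc n)
  have eq: "(gamma_poly (Suc n) :: real \<Rightarrow> real) = (\<lambda>x. of_nat (Suc n) * gamma_poly n x + x ^ Suc n)"
    by auto
  show ?case
    unfolding eq
    by (rule derivative_eq_intros Suc refl)+ (simp add: algebra_simps)
qed

lemma exp_gamma_poly_tendsto_0:
  "((\<lambda>x :: real. exp (- x) * gamma_poly n x) \<longlongrightarrow> 0) at_top"
proof (induction n)
  case 0
  have "((\<lambda>x :: real. exp (- x)) \<longlongrightarrow> 0) at_top"
    by (rule filterlim_compose[OF exp_at_bot filterlim_uminus_at_bot_at_top])
  then show ?case by simp
next
  case (Suc n)
  have "((\<lambda>x :: real. of_nat (Suc n) * (exp (- x) * gamma_poly n x) + x ^ Suc n / exp x)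
          \<longlongrightarrow> of_nat (Suc n) * 0 + 0) at_top"
    by (intro tendsto_intros Suc tendsto_power_div_exp_0)
  moreover have "of_nat (Suc n) * (exp (- x) * gamma_poly n x) + x ^ Suc n / exp x
      = exp (- x) * gamma_poly (Suc n) x" for x :: real
    by (simp add: exp_minus field_simps)
  ultimately show ?case by simp
qed

lemma has_integral_gamma_interval:
  fixes a b :: real
  assumes "a \<le> b"
  shows "((\<lambda>x. x ^ n * exp (- x)) has_integral
           (exp (- a) * gamma_poly n a - exp (- b) * gamma_poly n b)) {a..b}"
proof -
  have "((\<lambda>x. - (exp (- x) * gamma_poly n x)) has_vector_derivative x ^ n * exp (- x))
          (at x within {a..b})" for x :: real
  proof -
    have "((\<lambda>x. - (exp (- x) * gamma_poly n x)) has_real_derivative x ^ n * exp (- x)) (at x)"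
      by (rule derivative_eq_intros gamma_poly_has_real_derivative refl)+
        (simp add: algebra_simps)
    then show ?thesis
      by (simp add: has_real_derivative_iff_has_vector_derivative has_vector_derivative_at_within)
  qed
  then have "((\<lambda>x. x ^ n * exp (- x)) has_integral
      (- (exp (- b) * gamma_poly n b) - - (exp (- a) * gamma_poly n a))) {a..b}"
    by (intro fundamental_theorem_of_calculus assms)
  then show ?thesis by simp
qed

lemma has_integral_gamma_atLeast:
  fixes a :: real
  shows "((\<lambda>x. x ^ n * exp (- x)) has_integral exp (- a) * gamma_poly n a) {a..}"
proof -
  \<comment> \<open>\<open>has_integral_to_inf\<close> asks for a nonnegative integrand, which holds
    for every \<open>n\<close> only to the right of 0. A negative endpoint occurs for negative
    \<open>r\<close> and is treated by splitting the ray at 0.\<close>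
  have nonneg: "((\<lambda>x. x ^ n * exp (- x)) has_integral exp (- b) * gamma_poly n b) {b..}"
    if "b \<ge> 0" for b :: real
  proof (rule has_integral_to_inf)
    show "(\<lambda>x. x ^ n * exp (- x)) integrable_on {b..y}" for y :: real
      by (intro integrable_continuous_interval continuous_intros)
    have "\<forall>\<^sub>F y in at_top. exp (- b) * gamma_poly n b - exp (- y) * gamma_poly n y
        = integral {b..y} (\<lambda>x. x ^ n * exp (- x))"
      using eventually_ge_at_top[of b]
      by eventually_elim (simp add: integral_unique[OF has_integral_gamma_interval])
    moreover have "((\<lambda>y. exp (- b) * gamma_poly n b - exp (- y) * gamma_poly n y)
        \<longlongrightarrow> exp (- b) * gamma_poly n b - 0) at_top"
      by (intro tendsto_intros exp_gamma_poly_tendsto_0)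
    ultimately show "((\<lambda>y. integral {b..y} (\<lambda>x. x ^ n * exp (- x)))
        \<longlongrightarrow> exp (- b) * gamma_poly n b) at_top"
      by (simp add: filterlim_cong)
  qed (use that in auto)
  show ?thesis
  proof (cases "a \<ge> 0")
    case True
    then show ?thesis by (rule nonneg)
  next
    case False
    \<comment> \<open>The values at 0 stay in the form \<open>exp (- 0) * gamma_poly n 0\<close>, so
      that both integral facts match literally with endpoint 0.\<close>
    have "((\<lambda>x. x ^ n * exp (- x)) has_integral
        (exp (- a) * gamma_poly n a - exp (- 0) * gamma_poly n 0) + exp (- 0) * gamma_poly n 0)
        ({a..0} \<union> {0..})"
    proof (rule has_integral_Un)
      have "{a..0} \<inter> {0..} = {0}"
        using False by auto
      then show "negligible ({a..0} \<inter> {0..})" by simp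
    qed (use False in \<open>auto intro: has_integral_gamma_interval nonneg simp del: minus_zero\<close>)
    moreover have "{a..0} \<union> {0..} = {a..}"
      using False by auto
    ultimately show ?thesis by simp
  qed
qed

lemma inc_Gamma_Suc: "inc_Gamma (Suc n) a = exp (- a) * gamma_poly n a"
  unfolding inc_Gamma_def diff_Suc_1 by (rule integral_unique[OF has_integral_gamma_atLeast])

section \<open>Complete ultrametric fields\<close>

text \<open>The sort of \<open>'a\<close> puts a field and a complete metric side by side without
  relating them; these assumptions do so. The limit laws for \<open>'a\<close> are then reduced to
  limits of real absolute values.\<close>

locale ultrametric_field =
  fixes T :: "'a :: {field_char_0, complete_space} itself"
  assumes dist_eq_vabs: "dist x y = vabs (x - y :: 'a)"
    and vabs_mult: "vabs (x * y :: 'a) = vabs x * vabs y"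
    and vabs_add_le_max: "vabs (x + y :: 'a) \<le> max (vabs x) (vabs y)"
begin

lemma vabs_nonneg [simp]: "0 \<le> vabs (x :: 'a)"
  by (simp add: vabs_def)

lemma vabs_eq_0_iff [simp]: "vabs (x :: 'a) = 0 \<longleftrightarrow> x = 0"
  by (simp add: vabs_def)

lemma vabs_0 [simp]: "vabs (0 :: 'a) = 0"
  by simp

lemma vabs_1 [simp]: "vabs (1 :: 'a) = 1"
  using vabs_mult[of 1 1] by simp

lemma vabs_minus_commute: "vabs (x - y :: 'a) = vabs (y - x)"
  by (metis dist_commute dist_eq_vabs)

lemma vabs_minus [simp]: "vabs (- x :: 'a) = vabs x"
  using vabs_minus_commute[of 0 x] by simp

lemma vabs_diff_le_max: "vabs (x - y :: 'a) \<le> max (vabs x) (vabs y)"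
  using vabs_add_le_max[of x "- y"] by simp

lemma vabs_triangle: "vabs (x + y :: 'a) \<le> vabs x + vabs y"
  using vabs_add_le_max[of x y] vabs_nonneg[of x] vabs_nonneg[of y] by linarith

lemma vabs_add_le: "vabs x \<le> b \<Longrightarrow> vabs y \<le> b \<Longrightarrow> vabs (x + y :: 'a) \<le> b"
  using vabs_add_le_max[of x y] by simp

lemma vabs_diff_le: "vabs x \<le> b \<Longrightarrow> vabs y \<le> b \<Longrightarrow> vabs (x - y :: 'a) \<le> b"
  using vabs_diff_le_max[of x y] by simp

lemma vabs_power: "vabs (x ^ n :: 'a) = vabs x ^ n"
  by (induction n) (simp_all add: vabs_mult)

lemma vabs_divide: "vabs (x / y :: 'a) = vabs x / vabs y"
proof (cases "y = 0")
  case False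
  then show ?thesis
    using vabs_mult[of "x / y" y] by (simp add: field_simps)
qed simp

lemma vabs_prod: "vabs (prod f A :: 'a) = (\<Prod>i\<in>A. vabs (f i))"
  by (induction A rule: infinite_finite_induct) (simp_all add: vabs_mult)

lemma vabs_sum_le:
  "0 \<le> b \<Longrightarrow> (\<And>i. i \<in> A \<Longrightarrow> vabs (f i) \<le> b) \<Longrightarrow> vabs (sum f A :: 'a) \<le> b"
  by (induction A rule: infinite_finite_induct) (auto intro: vabs_add_le)

section \<open>Limits and series over a complete ultrametric field\<close>

lemma tendsto_iff_vabs: "(X \<longlongrightarrow> (l :: 'a)) F \<longleftrightarrow> ((\<lambda>n. vabs (X n - l)) \<longlongrightarrow> 0) F"
  by (subst tendsto_dist_iff) (simp add: dist_eq_vabs)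

lemma tendsto_vabs_squeeze:
  assumes "\<forall>\<^sub>F n in F. vabs (X n - l :: 'a) \<le> h n" "(h \<longlongrightarrow> 0) F"
  shows "(X \<longlongrightarrow> l) F"
  unfolding tendsto_iff_vabs
  by (rule tendsto_sandwich[OF _ assms(1) tendsto_const assms(2)]) simp

lemma tendsto_add_ultra:
  assumes "(X \<longlongrightarrow> (l :: 'a)) F" "(Y \<longlongrightarrow> m) F"
  shows "((\<lambda>n. X n + Y n) \<longlongrightarrow> l + m) F"
proof (rule tendsto_vabs_squeeze)
  show "\<forall>\<^sub>F n in F. vabs (X n + Y n - (l + m)) \<le> vabs (X n - l) + vabs (Y n - m)"
    using vabs_triangle by (auto intro!: always_eventually simp: add_diff_add)
  show "((\<lambda>n. vabs (X n - l) + vabs (Y n - m)) \<longlongrightarrow> 0) F"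
    using tendsto_add[of "\<lambda>n. vabs (X n - l)" 0 F "\<lambda>n. vabs (Y n - m)" 0] assms
    by (simp add: tendsto_iff_vabs)
qed

lemma tendsto_mult_left_ultra:
  assumes "(X \<longlongrightarrow> (l :: 'a)) F"
  shows "((\<lambda>n. c * X n) \<longlongrightarrow> c * l) F"
proof (rule tendsto_vabs_squeeze)
  show "\<forall>\<^sub>F n in F. vabs (c * X n - c * l) \<le> vabs c * vabs (X n - l)"
    by (simp add: vabs_mult right_diff_distrib[symmetric])
  show "((\<lambda>n. vabs c * vabs (X n - l)) \<longlongrightarrow> 0) F"
    using tendsto_mult_left[of "\<lambda>n. vabs (X n - l)" 0 F "vabs c"] assms
    by (simp add: tendsto_iff_vabs)
qed

lemma tendsto_diff_ultra:
  assumes "(X \<longlongrightarrow> (l :: 'a)) F" "(Y \<longlongrightarrow> m) F"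
  shows "((\<lambda>n. X n - Y n) \<longlongrightarrow> l - m) F"
  using tendsto_add_ultra[OF assms(1) tendsto_mult_left_ultra[OF assms(2), of "- 1"]] by simp

lemma sums_add_ultra: "f sums (a :: 'a) \<Longrightarrow> g sums b \<Longrightarrow> (\<lambda>n. f n + g n) sums (a + b)"
  unfolding sums_def by (simp add: sum.distrib tendsto_add_ultra)

lemma sums_mult_ultra: "f sums (a :: 'a) \<Longrightarrow> (\<lambda>n. c * f n) sums (c * a)"
  unfolding sums_def by (simp add: sum_distrib_left[symmetric] tendsto_mult_left_ultra)

lemma sums_diff_ultra: "f sums (a :: 'a) \<Longrightarrow> g sums b \<Longrightarrow> (\<lambda>n. f n - g n) sums (a - b)"
  using sums_add_ultra[OF _ sums_mult_ultra[of g b "- 1"]] by simp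

lemma sums_sum_ultra:
  "(\<And>i. i < k \<Longrightarrow> f i sums (a i :: 'a)) \<Longrightarrow> (\<lambda>n. \<Sum>i<k. f i n) sums (\<Sum>i<k. a i)"
  for k :: nat
  by (induction k) (simp_all add: sums_add_ultra)

text \<open>A block of consecutive terms is no larger than its largest term. Terms that tend to 0
  therefore make the partial sums Cauchy, and completeness gives the limit.\<close>

lemma summable_ultra:
  assumes "(\<lambda>n. vabs (f n :: 'a)) \<longlonglongrightarrow> 0"
  shows "summable f"
proof -
  have "Cauchy (\<lambda>n. \<Sum>i<n. f i)"
  proof (rule metric_CauchyI)
    fix e :: real
    assume "e > 0"
    then obtain N where N: "\<And>n. n \<ge> N \<Longrightarrow> vabs (f n) < e / 2"
      using order_tendstoD(2)[OF assms, of "e / 2"] by (auto simp: eventually_sequentially)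
    have *: "dist (\<Sum>i<m. f i) (\<Sum>i<n. f i) < e" if "N \<le> n" "n \<le> m" for m n
    proof -
      have "(\<Sum>i<m. f i) - (\<Sum>i<n. f i) = (\<Sum>i\<in>{n..<m}. f i)"
        using sum_diff_nat_ivl[of 0 n m f] that by (simp add: lessThan_atLeast0)
      moreover have "vabs (\<Sum>i\<in>{n..<m}. f i) \<le> e / 2"
        using that \<open>e > 0\<close> N by (intro vabs_sum_le) (auto intro!: less_imp_le)
      ultimately show ?thesis
        using \<open>e > 0\<close> by (simp add: dist_eq_vabs)
    qed
    then show "\<exists>N. \<forall>m\<ge>N. \<forall>n\<ge>N. dist (\<Sum>i<m. f i) (\<Sum>i<n. f i) < e"
      by (metis dist_commute nle_le)
  qed
  then show ?thesis
    by (simp add: summable_iff_convergent Cauchy_convergent_iff)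
qed

lemma summable_ultra_comparison:
  assumes "\<And>n. vabs (f n :: 'a) \<le> h n" "h \<longlonglongrightarrow> 0"
  shows "summable f"
proof (rule summable_ultra)
  show "(\<lambda>n. vabs (f n)) \<longlonglongrightarrow> 0"
    by (rule tendsto_sandwich[OF _ _ tendsto_const assms(2)]) (simp_all add: assms(1))
qed

text \<open>If \<open>l\<close> exceeded the bound, a late term would have absolute value below
  \<open>vabs l\<close> and also be closer to \<open>l\<close> than \<open>vabs l\<close>, against
  the ultrametric inequality.\<close>

lemma vabs_le_of_tendsto:
  assumes "X \<longlonglongrightarrow> (l :: 'a)" "\<forall>\<^sub>F n in sequentially. vabs (X n) \<le> b"
  shows "vabs l \<le> b"
proof (rule ccontr)
  assume "\<not> vabs l \<le> b"
  moreover obtain N where N: "\<And>n. n \<ge> N \<Longrightarrow> vabs (X n) \<le> b"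
    using assms(2) by (auto simp: eventually_sequentially)
  ultimately have "0 < vabs l"
    using N[of N] vabs_nonneg[of "X N"] by linarith
  then obtain M where M: "\<And>n. n \<ge> M \<Longrightarrow> vabs (X n - l) < vabs l"
    using order_tendstoD(2)[OF assms(1)[unfolded tendsto_iff_vabs]]
    by (auto simp: eventually_sequentially)
  define n where "n = max M N"
  have n: "vabs (X n - l) < vabs l" "vabs (X n) \<le> b"
    using M N by (simp_all add: n_def)
  have "vabs l \<le> max (vabs (X n)) (vabs (X n - l))"
    using vabs_diff_le_max[of "X n" "X n - l"] by simp
  with n \<open>\<not> vabs l \<le> b\<close> show False by linarith
qed

lemma sums_vabs_le:
  assumes "f sums (s :: 'a)" "\<And>n. vabs (f n) \<le> b"
  shows "vabs s \<le> b"
proof (rule vabs_le_of_tendsto)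
  show "(\<lambda>n. \<Sum>i<n. f i) \<longlonglongrightarrow> s"
    using assms(1) by (simp add: sums_def)
  have "0 \<le> b"
    using assms(2)[of 0] vabs_nonneg[of "f 0"] by linarith
  then show "\<forall>\<^sub>F n in sequentially. vabs (\<Sum>i<n. f i) \<le> b"
    using assms(2) by (intro always_eventually allI vabs_sum_le)
qed

text \<open>The product of two partial sums runs over a square and the partial Cauchy product over a
  triangle inside it. Every term in between has \<open>N \<le> i + j\<close>, hence size at most
  \<open>\<rho> ^ N\<close>, and by the ultrametric inequality so has their sum.\<close>

lemma cauchy_product_sums_ultra:
  assumes f: "f sums (a :: 'a)" and g: "g sums b"
    and f_le: "\<And>n. vabs (f n) \<le> \<rho> ^ n" and g_le: "\<And>n. vabs (g n) \<le> \<rho> ^ n"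
    and \<rho>: "0 \<le> \<rho>" "\<rho> < 1"
  shows "(\<lambda>n. \<Sum>i\<le>n. f i * g (n - i)) sums (a * b)"
proof -
  define F where "F N = (\<Sum>i<N. f i)" for N
  define G where "G N = (\<Sum>i<N. g i)" for N
  define H where "H N = (\<Sum>n<N. \<Sum>i\<le>n. f i * g (n - i))" for N
  have bound: "vabs (F N * G N - H N) \<le> \<rho> ^ N" for N
  proof -
    have "F N * G N = (\<Sum>(i, j)\<in>{..<N} \<times> {..<N}. f i * g j)"
      by (simp add: F_def G_def sum_product sum.cartesian_product)
    moreover have "H N = (\<Sum>(i, j)\<in>{(i, j). i + j < N}. f i * g j)"
      unfolding H_def by (rule sum.triangle_reindex[symmetric])
    moreover have "{(i, j). i + j < N} \<subseteq> {..<N} \<times> {..<N}"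
      by auto
    ultimately have "F N * G N - H N =
        (\<Sum>(i, j)\<in>{..<N} \<times> {..<N} - {(i, j). i + j < N}. f i * g j)"
      by (simp add: sum_diff)
    also have "vabs \<dots> \<le> \<rho> ^ N"
    proof (rule vabs_sum_le)
      fix x
      assume x: "x \<in> {..<N} \<times> {..<N} - {(i, j). i + j < N}"
      obtain i j where ij: "x = (i, j)" "N \<le> i + j"
        using x by (cases x) auto
      have "vabs (f i * g j) \<le> \<rho> ^ i * \<rho> ^ j"
        unfolding vabs_mult using \<rho> by (intro mult_mono f_le g_le) auto
      also have "\<dots> \<le> \<rho> ^ N"
        using ij \<rho> by (simp add: power_add[symmetric] power_decreasing)
      finally show "vabs (case x of (i, j) \<Rightarrow> f i * g j) \<le> \<rho> ^ N"
        by (simp add: ij)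
    qed (use \<rho> in simp)
    finally show ?thesis .
  qed
  have F_le: "vabs (F N) \<le> 1" for N
    unfolding F_def
  proof (rule vabs_sum_le)
    show "vabs (f i) \<le> 1" for i
      using f_le[of i] power_le_one[of \<rho> i] \<rho> by linarith
  qed simp
  \<comment> \<open>The argument of the limit equals \<open>H N\<close>. In this form only limits of
    sums and of constant multiples occur, together with the product of the bounded
    \<open>F N\<close> and the null sequence \<open>G N - b\<close>.\<close>
  have "(\<lambda>N. F N * (G N - b) + b * F N - (F N * G N - H N)) \<longlonglongrightarrow> 0 + b * a - 0"
  proof (intro tendsto_diff_ultra tendsto_add_ultra tendsto_mult_left_ultra)
    show "F \<longlonglongrightarrow> a"
      using f by (simp add: F_def[abs_def] sums_def)
    show "(\<lambda>N. F N * G N - H N) \<longlonglongrightarrow> 0"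
      by (rule tendsto_vabs_squeeze[where h = "\<lambda>N. \<rho> ^ N"])
        (use bound \<rho> in \<open>auto intro: LIMSEQ_realpow_zero\<close>)
    show "(\<lambda>N. F N * (G N - b)) \<longlonglongrightarrow> 0"
    proof (rule tendsto_vabs_squeeze[where h = "\<lambda>N. vabs (G N - b)"])
      show "\<forall>\<^sub>F N in sequentially. vabs (F N * (G N - b) - 0) \<le> vabs (G N - b)"
        using F_le by (simp add: vabs_mult mult_left_le_one_le)
      show "(\<lambda>N. vabs (G N - b)) \<longlonglongrightarrow> 0"
        using g by (simp add: G_def sums_def tendsto_iff_vabs)
    qed
  qed
  then show ?thesis
    by (simp add: sums_def H_def algebra_simps)
qed

end

section \<open>The field of \<open>p\<close>-adic numbers\<close>

lemma multiplicity_fact: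
  fixes p :: nat
  assumes "prime p"
  shows "multiplicity p (fact n) = n div p + multiplicity p (fact (n div p))"
proof (induction n)
  case 0
  show ?case by simp
next
  case (Suc n)
  have p: "prime_elem p" and "p > 0"
    using assms prime_gt_0_nat by auto
  have step: "multiplicity p (fact (Suc k)) = multiplicity p (Suc k) + multiplicity p (fact k)" for k
    using prime_elem_multiplicity_mult_distrib[OF p, of "Suc k" "fact k"] by simp
  show ?case
  proof (cases "p dvd Suc n")
    case True
    then obtain m where m: "Suc n = p * m" ..
    then have "m \<noteq> 0" by (intro notI) simp
    have "Suc (n div p) = m"
      using True m \<open>p > 0\<close> div_Suc[of n p] by (simp add: mod_eq_0_iff_dvd)
    then have "n div p = m - 1" "Suc (m - 1) = m" by auto
    have "multiplicity p (Suc n) = Suc (multiplicity p m)"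
      using prime_elem_multiplicity_mult_distrib[OF p, of p m] \<open>m \<noteq> 0\<close> \<open>p > 0\<close> p
      by (simp add: m prime_elem_def)
    moreover have "Suc n div p = m"
      using m \<open>p > 0\<close> by simp
    ultimately show ?thesis
      using Suc step[of n] step[of "m - 1"] \<open>n div p = m - 1\<close> \<open>Suc (m - 1) = m\<close> \<open>m \<noteq> 0\<close>
      by (simp del: fact_Suc)
  next
    case False
    then have "Suc n div p = n div p"
      by (simp add: div_Suc mod_eq_0_iff_dvd)
    then show ?thesis
      using Suc step[of n] not_dvd_imp_multiplicity_0[OF False] by (simp del: fact_Suc)
  qed
qed

text \<open>Legendre's bound \<open>n / (p - 1)\<close>, freed of the division. With
  \<open>q = n div p\<close>, the recursion and the induction hypothesis for \<open>q\<close> bound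
  the left side by \<open>(p - 1) * q + q = p * q\<close>.\<close>

lemma multiplicity_fact_le:
  fixes p :: nat
  assumes "prime p"
  shows "(p - 1) * multiplicity p (fact n) \<le> n"
proof (induction n rule: less_induct)
  case (less n)
  have p: "p > 1"
    using assms prime_gt_1_nat by blast
  show ?case
  proof (cases "n = 0")
    case False
    then have "(p - 1) * multiplicity p (fact (n div p)) \<le> n div p"
      using p by (intro less) simp
    then have "(p - 1) * multiplicity p (fact n) \<le> (p - 1) * (n div p) + n div p"
      by (subst multiplicity_fact[OF assms]) (simp add: add_mult_distrib2)
    also have "\<dots> = p * (n div p)"
      using p by (cases p) simp_all
    also have "\<dots> \<le> n" by simp
    finally show ?thesis .
  qed simp
qed

lemma multiplicity_of_nat_int: "multiplicity (int p) (int n) = multiplicity p n"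
  by (simp add: multiplicity_def flip: of_nat_power)

section \<open>Falling factorials and their expansion about a point\<close>

definition falling_fact :: "'a :: comm_ring_1 \<Rightarrow> nat \<Rightarrow> 'a" where
  "falling_fact x n = (\<Prod>i<n. x - of_nat i)"

lemma falling_fact_0 [simp]: "falling_fact x 0 = 1"
  by (simp add: falling_fact_def)

lemma falling_fact_Suc: "falling_fact x (Suc n) = falling_fact x n * (x - of_nat n)"
  by (simp add: falling_fact_def)

lemma falling_fact_Suc_shift: "falling_fact x (Suc n) = x * falling_fact (x - 1) n"
  by (simp add: falling_fact_def prod.lessThan_Suc_shift algebra_simps del: prod.lessThan_Suc)

lemma gbinomial_falling_fact: "(x :: 'a :: field_char_0) gchoose n = falling_fact x n / fact n"
  by (simp add: gbinomial_prod_rev falling_fact_def atLeast0LessThan)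

text \<open>The Taylor expansion of the falling factorial about \<open>x\<close>, in the
  displacement from \<open>x\<close>. The product of linear factors allows the coefficients to be
  estimated one factor at a time.\<close>

definition falling_fact_poly :: "'a :: comm_ring_1 \<Rightarrow> nat \<Rightarrow> 'a poly" where
  "falling_fact_poly x n = (\<Prod>i<n. [:x - of_nat i, 1:])"

lemma poly_falling_fact_poly: "poly (falling_fact_poly x n) y = falling_fact (x + y) n"
  by (simp add: falling_fact_poly_def falling_fact_def poly_prod algebra_simps)

lemma degree_falling_fact_poly_le: "degree (falling_fact_poly x n) \<le> n"
proof -
  have "degree (falling_fact_poly x n) \<le> (\<Sum>i<n. degree [:x - of_nat i, 1:])"
    unfolding falling_fact_poly_def
    using degree_prod_sum_le[of "{..<n}" "\<lambda>i. [:x - of_nat i, 1:]"] by (simp add: o_def)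
  also have "\<dots> \<le> n"
    by simp
  finally show ?thesis .
qed

locale padic_field = ultrametric_field T
  for T :: "'a :: {field_char_0, complete_space} itself" +
  fixes p :: nat
  assumes prime_p: "prime p"
    and vabs_of_int:
      "m \<noteq> 0 \<Longrightarrow> vabs (of_int m :: 'a) = 1 / real p ^ multiplicity (int p) m"
begin

section \<open>Absolute values of integers, and density of the naturals in \<open>Zp\<close>\<close>

lemma p_gt_1: "real p > 1"
  using prime_gt_1_nat[OF prime_p] by simp

lemma inverse_p: "0 < 1 / real p" "1 / real p < 1"
  using p_gt_1 by (simp_all add: field_simps)

lemma vabs_of_int_le_1: "vabs (of_int m :: 'a) \<le> 1"
  using p_gt_1 by (cases "m = 0") (simp_all add: vabs_of_int field_simps)

lemma vabs_of_nat_le_1: "vabs (of_nat n :: 'a) \<le> 1"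
  using vabs_of_int_le_1[of "int n"] by simp

lemma vabs_of_int_le:
  assumes "int p ^ k dvd m"
  shows "vabs (of_int m :: 'a) \<le> (1 / real p) ^ k"
proof (cases "m = 0")
  case False
  then have "k \<le> multiplicity (int p) m"
    using assms prime_gt_1_nat[OF prime_p] by (intro multiplicity_geI) auto
  then have "1 / real p ^ multiplicity (int p) m \<le> 1 / real p ^ k"
    using p_gt_1 by (intro divide_left_mono power_increasing) auto
  then show ?thesis
    using False by (simp add: vabs_of_int power_one_over)
qed (use p_gt_1 in simp)

lemma vabs_of_int_eq_1: "\<not> int p dvd m \<Longrightarrow> vabs (of_int m :: 'a) = 1"
  by (cases "m = 0") (auto simp: vabs_of_int not_dvd_imp_multiplicity_0)

lemma vabs_fact: "vabs (fact n :: 'a) = 1 / real p ^ multiplicity p (fact n)"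
proof -
  have "vabs (of_int (int (fact n)) :: 'a) = 1 / real p ^ multiplicity (int p) (int (fact n))"
    by (rule vabs_of_int) simp
  also have "of_int (int (fact n)) = (fact n :: 'a)"
    by (metis of_int_of_nat_eq of_nat_fact)
  finally show ?thesis
    by (simp only: multiplicity_of_nat_int)
qed

lemma Nats_subset_Zp: "\<nat> \<subseteq> (Zp :: 'a set)"
proof
  fix x :: 'a
  assume "x \<in> \<nat>"
  then obtain n where "x = of_nat n"
    by (rule Nats_cases)
  then show "x \<in> Zp"
    using vabs_of_nat_le_1[of n] closure_subset[of \<rat>] by (auto simp: Zp_def Qp_def)
qed

lemma of_nat_in_Zp [simp]: "(of_nat n :: 'a) \<in> Zp"
  using Nats_subset_Zp by auto

lemma Zp_diff_1:
  assumes "(x :: 'a) \<in> Zp"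
  shows "x - 1 \<in> Zp"
proof -
  have "x - 1 \<in> closure \<rat>"
    unfolding closure_approachable
  proof (intro allI impI)
    fix e :: real
    assume "e > 0"
    then obtain q where "q \<in> \<rat>" "dist q x < e"
      using assms by (auto simp: Zp_def Qp_def closure_approachable)
    then show "\<exists>q\<in>\<rat>. dist q (x - 1) < e"
      by (intro bexI[of _ "q - 1"]) (auto simp: dist_eq_vabs)
  qed
  then show ?thesis
    using assms by (auto simp: Zp_def Qp_def intro: vabs_diff_le)
qed

text \<open>A rational \<open>a / b\<close> near \<open>x\<close> has absolute value at most 1, so
  in lowest terms \<open>b\<close> is prime to \<open>p\<close>. Then \<open>b * m = a\<close> is
  solvable modulo any power of \<open>p\<close>, and a natural solution \<open>m\<close> is close to
  \<open>a / b\<close>.\<close>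

lemma Zp_subset_closure_Nats: "(Zp :: 'a set) \<subseteq> closure \<nat>"
proof
  fix x :: 'a
  assume x: "x \<in> Zp"
  show "x \<in> closure \<nat>"
    unfolding closure_approachable
  proof (intro allI impI)
    fix e :: real
    assume "e > 0"
    then obtain q where q: "q \<in> \<rat>" "dist q x < min e 1"
      using x by (auto simp: Zp_def Qp_def closure_approachable dest!: spec[of _ "min e 1"])
    have "vabs q \<le> 1"
      using vabs_add_le[of "q - x" 1 x] q x by (simp add: Zp_def dist_eq_vabs)
    obtain a b where ab: "b > 0" "coprime a b" "q = of_int a / of_int b"
      using q(1) by (rule Rats_cases')
    have b: "\<not> int p dvd b"
    proof
      assume dvd: "int p dvd b"
      then have "\<not> int p dvd a"
        using ab(2) prime_p by (metis coprime_common_divisor not_prime_unit prime_nat_int_transfer)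
      then have "vabs (of_int a :: 'a) = 1"
        by (rule vabs_of_int_eq_1)
      moreover have "vabs (of_int b :: 'a) < 1"
        using vabs_of_int_le[of 1 b] dvd by (intro le_less_trans[OF _ inverse_p(2)]) simp
      moreover have "vabs (of_int b :: 'a) > 0"
        using ab(1) vabs_nonneg[of "of_int b"] by (simp add: less_le)
      ultimately show False
        using \<open>vabs q \<le> 1\<close> by (simp add: ab(3) vabs_divide field_simps)
    qed
    obtain N where N: "(1 / real p) ^ N < e"
      using real_arch_pow_inv[OF \<open>e > 0\<close> inverse_p(2)] by blast
    have "coprime b (int p ^ N)"
      using b prime_p prime_imp_coprime[of "int p" b] by (simp add: coprime_commute)
    then obtain c where c: "[b * c = 1] (mod int p ^ N)"
      using cong_solve_coprime_int by blast
    define m where "m = nat ((c * a) mod int p ^ N)"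
    have "int m = (c * a) mod int p ^ N"
      using p_gt_1 by (simp add: m_def)
    then have "[b * int m = b * (c * a)] (mod int p ^ N)"
      by (simp add: cong_def mod_mult_right_eq)
    also have "[b * (c * a) = 1 * a] (mod int p ^ N)"
      using cong_scalar_right[OF c, of a] by (simp add: mult.assoc)
    finally have "int p ^ N dvd b * int m - a"
      by (simp add: cong_iff_dvd_diff)
    then have "vabs (of_int (b * int m - a) :: 'a) \<le> (1 / real p) ^ N"
      by (rule vabs_of_int_le)
    moreover have "of_nat m - q = of_int (b * int m - a) / of_int b"
      using ab(1) by (simp add: ab(3) field_simps)
    ultimately have "vabs (of_nat m - q) < e"
      using N vabs_of_int_eq_1[OF b] by (simp add: vabs_divide)
    then have "dist (of_nat m) x < e"
      using q(2) vabs_add_le_max[of "of_nat m - q" "q - x"]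
      by (simp add: dist_eq_vabs max_def split: if_splits)
    then show "\<exists>y\<in>\<nat>. dist y x < e"
      using of_nat_in_Nats by blast
  qed
qed

subsection \<open>Falling factorial series\<close>

text \<open>A bound for the Gauss norm, on the disc of radius \<open>1 / p\<close> about \<open>x\<close>, of the falling
  factorial of length \<open>n\<close>.\<close>

definition gauss_bound :: "'a \<Rightarrow> nat \<Rightarrow> real" where
  "gauss_bound x n = (\<Prod>i<n. max (vabs (x - of_nat i)) (1 / real p))"

lemma gauss_bound_nonneg: "0 \<le> gauss_bound x n"
  unfolding gauss_bound_def by (intro prod_nonneg ballI) (simp add: le_max_iff_disj)

text \<open>The Gauss norm of radius \<open>1 / p\<close> is the maximum of the left side over
  \<open>k\<close>. A further factor \<open>c + y\<close> multiplies it by at most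
  \<open>max (vabs c) (1 / p)\<close>, since a new coefficient is \<open>c\<close> times an old one
  plus the old one of index one lower.\<close>

lemma vabs_coeff_falling_fact_poly_le:
  "vabs (coeff (falling_fact_poly x n) k) * (1 / real p) ^ k \<le> gauss_bound x n"
proof (induction n arbitrary: k)
  case 0
  show ?case
    using inverse_p by (simp add: falling_fact_poly_def gauss_bound_def)
next
  case (Suc n)
  define c where "c = x - of_nat n"
  define P where "P = falling_fact_poly x n"
  define B where "B = gauss_bound x n"
  have B: "gauss_bound x (Suc n) = B * max (vabs c) (1 / real p)" and "B \<ge> 0"
    using gauss_bound_nonneg by (simp_all add: gauss_bound_def B_def c_def)
  have IH: "vabs (coeff P k) * (1 / real p) ^ k \<le> B" for k
    using Suc by (simp add: P_def B_def)
  have poly: "falling_fact_poly x (Suc n) = P * [:c, 1:]"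
    by (simp add: falling_fact_poly_def P_def c_def)
  have 1: "vabs (coeff P k * c) * (1 / real p) ^ k \<le> gauss_bound x (Suc n)"
  proof -
    have "vabs (coeff P k) * (1 / real p) ^ k * vabs c \<le> B * max (vabs c) (1 / real p)"
      using IH \<open>B \<ge> 0\<close> by (intro mult_mono) auto
    then show ?thesis
      by (simp add: B vabs_mult mult_ac)
  qed
  show ?case
  proof (cases k)
    case 0
    then show ?thesis
      using 1 by (simp add: poly coeff_mult mult.commute)
  next
    case (Suc j)
    have "vabs (coeff P j) * (1 / real p) ^ j * (1 / real p) \<le> B * max (vabs c) (1 / real p)"
      using IH \<open>B \<ge> 0\<close> by (intro mult_mono) auto
    then have 2: "vabs (coeff P j) * (1 / real p) ^ k \<le> gauss_bound x (Suc n)"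
      by (simp add: B Suc mult_ac)
    have "P * [:c, 1:] = smult c P + pCons 0 P"
      by (simp add: mult.commute[of P])
    then have coeff: "coeff (P * [:c, 1:]) k = coeff P k * c + coeff P j"
      by (simp add: Suc)
    have "vabs (coeff P k * c + coeff P j) * (1 / real p) ^ k
        \<le> max (vabs (coeff P k * c)) (vabs (coeff P j)) * (1 / real p) ^ k"
      using inverse_p by (intro mult_right_mono vabs_add_le_max) simp
    also have "\<dots> \<le> gauss_bound x (Suc n)"
      using 1 2 by (auto simp: max_def)
    finally show ?thesis
      unfolding poly coeff .
  qed
qed

lemma vabs_falling_fact_le:
  assumes "vabs (y - x) \<le> 1 / real p"
  shows "vabs (falling_fact y n) \<le> gauss_bound x n"
  unfolding falling_fact_def gauss_bound_def vabs_prod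
proof (intro prod_mono conjI)
  fix i
  show "vabs (y - of_nat i) \<le> max (vabs (x - of_nat i)) (1 / real p)"
    using vabs_add_le_max[of "x - of_nat i" "y - x"] assms by auto
qed simp

context
  fixes x :: 'a
  assumes x: "x \<in> Zp"
begin

lemma vabs_diff_of_nat_le_1: "vabs (x - of_nat i) \<le> 1"
  using x vabs_of_nat_le_1 by (intro vabs_diff_le) (auto simp: Zp_def)

lemma gauss_bound_Suc_le: "gauss_bound x (Suc n) \<le> gauss_bound x n"
  using vabs_diff_of_nat_le_1[of n] inverse_p gauss_bound_nonneg[of x n]
  by (simp add: gauss_bound_def mult_left_le)

lemma gauss_bound_antimono: "m \<le> n \<Longrightarrow> gauss_bound x n \<le> gauss_bound x m"
  by (rule lift_Suc_antimono_le[of "gauss_bound x"]) (auto intro: gauss_bound_Suc_le)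

lemma gauss_bound_le_1: "gauss_bound x n \<le> 1"
  using gauss_bound_antimono[of 0 n] by (simp add: gauss_bound_def)

text \<open>Modulo \<open>p\<close>, \<open>x\<close> agrees with some natural \<open>m\<close>.
  Among \<open>p\<close> consecutive indices one is congruent to \<open>m\<close>; its factor is
  exactly \<open>1 / p\<close>, and the other factors are at most 1.\<close>

lemma gauss_bound_add_p_le: "gauss_bound x (n + p) \<le> gauss_bound x n * (1 / real p)"
proof -
  have "x \<in> closure \<nat>"
    using x Zp_subset_closure_Nats by blast
  then obtain y where "y \<in> \<nat>" "dist y x < 1 / real p"
    using inverse_p(1) unfolding closure_approachable by blast
  then obtain m where m: "vabs (x - of_nat m) < 1 / real p"
    by (auto simp: dist_eq_vabs vabs_minus_commute[of _ x] elim!: Nats_cases)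
  \<comment> \<open>The representative of \<open>m\<close> modulo \<open>p\<close> in the window
    from \<open>n\<close> to \<open>n + p - 1\<close>.\<close>
  define i where "i = n + nat ((int m - int n) mod int p)"
  have p: "p > 0"
    using prime_p prime_gt_0_nat by blast
  then have i: "n \<le> i" "i < n + p"
    by (simp_all add: i_def nat_less_iff)
  have "int i = int n + (int m - int n) mod int p"
    using p by (simp add: i_def)
  then have "int p dvd int m - int i"
    by (metis diff_diff_eq dvd_minus_mod)
  then have "vabs (of_nat m - of_nat i :: 'a) \<le> 1 / real p"
    using vabs_of_int_le[of 1 "int m - int i"] by simp
  then have "vabs (x - of_nat i) \<le> 1 / real p"
    using vabs_add_le[of "x - of_nat m" "1 / real p" "of_nat m - of_nat i"] m by simp
  moreover have "gauss_bound x (Suc i) =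
      gauss_bound x i * max (vabs (x - of_nat i)) (1 / real p)"
    by (simp add: gauss_bound_def)
  ultimately have "gauss_bound x (Suc i) = gauss_bound x i * (1 / real p)"
    by (simp add: max_def)
  also have "\<dots> \<le> gauss_bound x n * (1 / real p)"
    using i inverse_p by (intro mult_right_mono gauss_bound_antimono) auto
  finally show ?thesis
    using gauss_bound_antimono[of "Suc i" "n + p"] i by simp
qed

lemma gauss_bound_tendsto_0: "gauss_bound x \<longlonglongrightarrow> 0"
proof -
  have mult: "gauss_bound x (m * p) \<le> (1 / real p) ^ m" for m
  proof (induction m)
    case 0
    show ?case by (simp add: gauss_bound_def)
  next
    case (Suc m)
    have "gauss_bound x (m * p + p) \<le> gauss_bound x (m * p) * (1 / real p)"
      by (rule gauss_bound_add_p_le)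
    also have "\<dots> \<le> (1 / real p) ^ m * (1 / real p)"
      using Suc inverse_p by (intro mult_right_mono) auto
    finally show ?case by (simp add: add.commute mult.commute)
  qed
  have le: "gauss_bound x n \<le> (1 / real p) ^ (n div p)" for n
    using gauss_bound_antimono[of "n div p * p" n] mult[of "n div p"] by simp
  have "filterlim (\<lambda>n. n div p) at_top at_top"
    using prime_p prime_gt_0_nat by (intro filterlim_at_top_div_const_nat) blast
  then have lim: "(\<lambda>n. (1 / real p) ^ (n div p)) \<longlonglongrightarrow> 0"
    using inverse_p by (intro filterlim_compose[OF LIMSEQ_realpow_zero]) auto
  show ?thesis
    by (rule tendsto_sandwich[OF _ _ tendsto_const lim])
      (use le gauss_bound_nonneg in \<open>auto intro: always_eventually\<close>)
qed

end

definition falling_series :: "(nat \<Rightarrow> 'a) \<Rightarrow> 'a \<Rightarrow> 'a" where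
  "falling_series c x = (\<Sum>n. c n * falling_fact x n)"

context
  fixes c :: "nat \<Rightarrow> 'a"
  assumes c_le: "vabs (c n) \<le> 1"
begin

lemma vabs_mult_c_le: "vabs y \<le> b \<Longrightarrow> vabs (c n * y) \<le> b"
  using c_le[of n] mult_left_le_one_le[of "vabs y" "vabs (c n)"] by (simp add: vabs_mult)

text \<open>The terms at \<open>y\<close> are dominated by the Gauss bound at \<open>x\<close>, so
  convergence holds on the whole disc about \<open>x\<close> in \<open>'a\<close>, also at points
  outside \<open>Zp\<close>.\<close>

lemma falling_series_sums:
  assumes "x \<in> Zp" "vabs (y - x) \<le> 1 / real p"
  shows "(\<lambda>n. c n * falling_fact y n) sums falling_series c y"
  unfolding falling_series_def
proof (rule summable_sums, rule summable_ultra_comparison[OF _ gauss_bound_tendsto_0[OF assms(1)]])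
  show "vabs (c n * falling_fact y n) \<le> gauss_bound x n" for n
    using assms(2) by (intro vabs_mult_c_le vabs_falling_fact_le)
qed

lemma falling_series_sums_Zp: "x \<in> Zp \<Longrightarrow> (\<lambda>n. c n * falling_fact x n) sums falling_series c x"
  using falling_series_sums[of x x] inverse_p by simp

text \<open>Each falling factorial is 1-Lipschitz on \<open>Zp\<close>: the product rule involves
  only factors of absolute value at most 1. The ultrametric inequality passes this bound to the
  series, which yields continuity.\<close>

lemma vabs_falling_series_diff_le:
  assumes x: "x \<in> Zp" and y: "y \<in> Zp"
  shows "vabs (falling_series c x - falling_series c y) \<le> vabs (x - y)"
proof -
  have ffact: "vabs (falling_fact x n - falling_fact y n) \<le> vabs (x - y)" for n
  proof (induction n)
    case (Suc n)
    have "falling_fact x (Suc n) - falling_fact y (Suc n) =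
        (falling_fact x n - falling_fact y n) * (x - of_nat n) + falling_fact y n * (x - y)"
      by (simp add: falling_fact_Suc algebra_simps)
    also have "vabs \<dots> \<le> vabs (x - y)"
    proof (rule vabs_add_le)
      have "vabs (falling_fact y n) \<le> 1"
        using vabs_falling_fact_le[of y y n] gauss_bound_le_1[OF y, of n] inverse_p by simp
      then show "vabs (falling_fact y n * (x - y)) \<le> vabs (x - y)"
        unfolding vabs_mult by (intro mult_left_le_one_le) auto
      show "vabs ((falling_fact x n - falling_fact y n) * (x - of_nat n)) \<le> vabs (x - y)"
        using mult_mono[OF Suc vabs_diff_of_nat_le_1[OF x, of n]] by (simp add: vabs_mult)
    qed
    finally show ?case .
  qed simp
  have "(\<lambda>n. c n * falling_fact x n - c n * falling_fact y n) sums
      (falling_series c x - falling_series c y)"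
    using assms by (intro sums_diff_ultra falling_series_sums_Zp)
  then show ?thesis
  proof (rule sums_vabs_le)
    show "vabs (c n * falling_fact x n - c n * falling_fact y n) \<le> vabs (x - y)" for n
      using vabs_mult_c_le[OF ffact] by (simp add: right_diff_distrib)
  qed
qed

lemma continuous_on_falling_series: "continuous_on Zp (falling_series c)"
  unfolding continuous_on_iff dist_eq_vabs
  using vabs_falling_series_diff_le by (meson le_less_trans)

text \<open>This interchanges the sums over \<open>n\<close> and \<open>k\<close> after expanding
  each falling factorial about \<open>x\<close>. It is legitimate because the terms are bounded by
  \<open>gauss_bound x n\<close> uniformly in \<open>k\<close>, and the n-th polynomial has degree
  at most \<open>n\<close>.\<close>

lemma falling_series_power_series:
  assumes x: "x \<in> Zp"
  shows "\<exists>a. \<forall>y. vabs (y - x) \<le> 1 / real p \<longrightarrow>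
    (\<lambda>k. a k * (y - x) ^ k) sums falling_series c y"
proof (intro exI allI impI)
  define P where "P n = falling_fact_poly x n" for n
  define a where "a k = (\<Sum>n. c n * coeff (P n) k)" for k
  have a_sums: "(\<lambda>n. c n * coeff (P n) k) sums a k" for k
    unfolding a_def
  proof (rule summable_sums, rule summable_ultra_comparison)
    \<comment> \<open>The factor \<open>real p ^ k\<close> undoes the weight
      \<open>(1 / real p) ^ k\<close> of the Gauss norm; it is constant here, since \<open>k\<close>
      is fixed.\<close>
    show "(\<lambda>n. real p ^ k * gauss_bound x n) \<longlonglongrightarrow> 0"
      using tendsto_mult_left[OF gauss_bound_tendsto_0[OF x], of "real p ^ k"] by simp
    show "vabs (c n * coeff (P n) k) \<le> real p ^ k * gauss_bound x n" for n
    proof (rule vabs_mult_c_le)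
      show "vabs (coeff (P n) k) \<le> real p ^ k * gauss_bound x n"
        using vabs_coeff_falling_fact_poly_le[of x n k] p_gt_1
        by (simp add: P_def field_simps)
    qed
  qed
  fix y :: 'a
  assume y: "vabs (y - x) \<le> 1 / real p"
  define z where "z = y - x"
  have coeff_le: "vabs (coeff (P n) k * z ^ k) \<le> gauss_bound x n" for n k
  proof -
    have "vabs (coeff (P n) k * z ^ k) \<le> vabs (coeff (P n) k) * (1 / real p) ^ k"
      unfolding vabs_mult vabs_power z_def using y by (intro mult_left_mono power_mono) auto
    then show ?thesis
      using vabs_coeff_falling_fact_poly_le[of x n k] by (simp add: P_def)
  qed
  have falling: "falling_fact y n = (\<Sum>k\<le>n. coeff (P n) k * z ^ k)" for n
  proof -
    have "falling_fact y n = poly (P n) z"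
      by (simp add: P_def poly_falling_fact_poly z_def)
    also have "\<dots> = (\<Sum>k\<le>n. coeff (P n) k * z ^ k)"
      unfolding poly_altdef
      using degree_falling_fact_poly_le[of x n]
      by (intro sum.mono_neutral_left) (auto simp: P_def coeff_eq_0)
    finally show ?thesis .
  qed
  have bound: "vabs ((\<Sum>k<N. a k * z ^ k) - falling_series c y) \<le> gauss_bound x N" for N
  proof (rule sums_vabs_le)
    show "(\<lambda>n. (\<Sum>k<N. z ^ k * (c n * coeff (P n) k)) - c n * falling_fact y n) sums
        ((\<Sum>k<N. a k * z ^ k) - falling_series c y)"
      using sums_mult_ultra[OF a_sums] x y
      by (intro sums_diff_ultra sums_sum_ultra falling_series_sums) (simp_all add: mult.commute[of "a _"])
    fix n
    \<comment> \<open>\<open>W\<close> is common to the truncation at \<open>N\<close> and to the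
      full expansion. The surplus \<open>U\<close> of the truncation vanishes by the degree bound.
      The missing part \<open>V\<close> is empty for \<open>n < N\<close> and otherwise at most
      \<open>gauss_bound x n\<close>, hence at most \<open>gauss_bound x N\<close>.\<close>
    define U where "U = (\<Sum>k\<in>{..<N} - {..n}. coeff (P n) k * z ^ k)"
    define V where "V = (\<Sum>k\<in>{..n} - {..<N}. coeff (P n) k * z ^ k)"
    define W where "W = (\<Sum>k\<in>{..n} \<inter> {..<N}. coeff (P n) k * z ^ k)"
    have "U = 0"
      unfolding U_def
      using degree_falling_fact_poly_le[of x n]
      by (intro sum.neutral) (auto simp: P_def coeff_eq_0)
    have "vabs V \<le> gauss_bound x N"
    proof (cases "N \<le> n")
      case True
      then have "gauss_bound x n \<le> gauss_bound x N"
        by (rule gauss_bound_antimono[OF x])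
      then show ?thesis
        unfolding V_def using coeff_le gauss_bound_nonneg
        by (intro vabs_sum_le) (auto intro: order_trans)
    next
      case False
      then have "V = 0"
        unfolding V_def by (intro sum.neutral) auto
      then show ?thesis
        by (simp add: gauss_bound_nonneg)
    qed
    moreover have "(\<Sum>k<N. coeff (P n) k * z ^ k) = W + U"
      unfolding W_def U_def by (subst sum.Int_Diff[of _ _ "{..n}"]) (simp_all add: Int_commute)
    moreover have "falling_fact y n = W + V"
      unfolding falling W_def V_def by (subst sum.Int_Diff[of _ _ "{..<N}"]) simp_all
    moreover have "(\<Sum>k<N. z ^ k * (c n * coeff (P n) k)) = c n * (\<Sum>k<N. coeff (P n) k * z ^ k)"
      by (simp add: sum_distrib_left mult_ac)
    ultimately show "vabs ((\<Sum>k<N. z ^ k * (c n * coeff (P n) k)) - c n * falling_fact y n)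
        \<le> gauss_bound x N"
      using vabs_mult_c_le[of "- V" "gauss_bound x N" n] \<open>U = 0\<close> by (simp add: algebra_simps)
  qed
  show "(\<lambda>k. a k * (y - x) ^ k) sums falling_series c y"
    unfolding sums_def
    by (rule tendsto_vabs_squeeze[OF always_eventually gauss_bound_tendsto_0[OF x]])
      (use bound in \<open>simp add: z_def\<close>)
qed

end

subsection \<open>The exponential series\<close>

lemma vabs_power_div_fact:
  "vabs (x ^ n / fact n :: 'a) = vabs x ^ n * real p ^ multiplicity p (fact n)"
  by (simp add: vabs_divide vabs_power vabs_fact)

text \<open>Legendre's bound gives at most \<open>n\<close> factors \<open>p\<close> in
  \<open>n!\<close>, as \<open>p - 1 \<ge> 1\<close>. Boundedness is all that can be expected on
  this disc: for \<open>p = 2\<close> and \<open>vabs x = 1 / 2\<close> the terms do not tend to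
  0.\<close>

lemma vabs_power_div_fact_le_1:
  assumes "vabs (x :: 'a) \<le> 1 / real p"
  shows "vabs (x ^ n / fact n) \<le> 1"
proof -
  have "1 * multiplicity p (fact n) \<le> (p - 1) * multiplicity p (fact n)"
    using prime_gt_1_nat[OF prime_p] by (intro mult_right_mono) auto
  then have "multiplicity p (fact n) \<le> n"
    using multiplicity_fact_le[OF prime_p, of n] by linarith
  then have "real p ^ multiplicity p (fact n) \<le> real p ^ n"
    using p_gt_1 by (intro power_increasing) auto
  moreover have "vabs x ^ n \<le> (1 / real p) ^ n"
    using assms by (intro power_mono) auto
  ultimately have "vabs x ^ n * real p ^ multiplicity p (fact n) \<le> (1 / real p) ^ n * real p ^ n"
    by (intro mult_mono) auto
  then show ?thesis
    using p_gt_1 by (simp add: vabs_power_div_fact power_one_over)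
qed

text \<open>The ratio of a geometric majorant of the exponential series. The square root appears
  because, for odd \<open>p\<close>, dividing by \<open>n!\<close> can cost up to half of the decay
  \<open>(1 / p) ^ n\<close>.\<close>

definition exp_ratio :: real where
  "exp_ratio = sqrt (1 / real p)"

text \<open>In terms of \<open>p\<close> the radius is \<open>1 / p\<close> for odd \<open>p\<close>
  and \<open>1 / 4\<close> for \<open>p = 2\<close>, which is the absolute value of
  \<open>p_tilde p\<close>.\<close>

definition exp_domain :: "'a set" where
  "exp_domain = {x. vabs x \<le> exp_ratio ^ (if p = 2 then 4 else 2)}"

lemma exp_ratio: "0 < exp_ratio" "exp_ratio < 1" "exp_ratio\<^sup>2 = 1 / real p"
  using inverse_p by (simp_all add: exp_ratio_def)

lemma vabs_power_div_fact_le: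
  assumes "x \<in> exp_domain"
  shows "vabs (x ^ n / fact n) \<le> exp_ratio ^ n"
proof -
  define m where "m = multiplicity p (fact n)"
  define e :: nat where "e = (if p = 2 then 4 else 2)"
  have "p - 1 \<ge> (if p = 2 then 1 else 2)"
    using prime_ge_2_nat[OF prime_p] by auto
  then have "(if p = 2 then 1 else 2) * m \<le> (p - 1) * m"
    by (rule mult_right_mono) simp
  also have "\<dots> \<le> n"
    unfolding m_def by (rule multiplicity_fact_le[OF prime_p])
  \<comment> \<open>Counted in powers of \<open>exp_ratio\<close>, \<open>x ^ n\<close> supplies at
    least \<open>e * n\<close> and division by \<open>n!\<close> removes \<open>2 * m\<close>. At
    least \<open>n\<close> powers remain.\<close>
  finally have "n + 2 * m \<le> e * n"
    by (auto simp: e_def split: if_splits)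
  then have "exp_ratio ^ (e * n) \<le> exp_ratio ^ (n + 2 * m)"
    using exp_ratio by (intro power_decreasing) auto
  also have "\<dots> = exp_ratio ^ n * (1 / real p) ^ m"
    by (simp add: power_add power_mult exp_ratio(3))
  finally have "exp_ratio ^ (e * n) * real p ^ m \<le> exp_ratio ^ n"
    using p_gt_1 by (simp add: field_simps)
  moreover have "vabs x ^ n \<le> exp_ratio ^ (e * n)"
    using assms power_mono[of "vabs x" "exp_ratio ^ e" n]
    by (simp add: exp_domain_def e_def power_mult)
  then have "vabs x ^ n * real p ^ m \<le> exp_ratio ^ (e * n) * real p ^ m"
    by (rule mult_right_mono) simp
  ultimately show ?thesis
    by (simp add: vabs_power_div_fact m_def)
qed

lemma padic_exp_sums:
  assumes "x \<in> exp_domain"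
  shows "(\<lambda>n. x ^ n / fact n) sums padic_exp x"
  unfolding padic_exp_def
proof (rule summable_sums, rule summable_ultra_comparison[OF vabs_power_div_fact_le[OF assms]])
  show "(\<lambda>n. exp_ratio ^ n) \<longlonglongrightarrow> 0"
    using exp_ratio by (intro LIMSEQ_realpow_zero) auto
qed

lemma exp_domain_add: "x \<in> exp_domain \<Longrightarrow> y \<in> exp_domain \<Longrightarrow> x + y \<in> exp_domain"
  by (auto simp: exp_domain_def intro: vabs_add_le)

lemma padic_exp_add:
  assumes "x \<in> exp_domain" "y \<in> exp_domain"
  shows "padic_exp (x + y) = padic_exp x * padic_exp y"
proof -
  have "(\<lambda>n. \<Sum>i\<le>n. x ^ i / fact i * (y ^ (n - i) / fact (n - i))) sums (padic_exp x * padic_exp y)"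
    using assms exp_ratio
    by (intro cauchy_product_sums_ultra[where \<rho> = exp_ratio] padic_exp_sums vabs_power_div_fact_le)
      auto
  moreover have "(\<Sum>i\<le>n. x ^ i / fact i * (y ^ (n - i) / fact (n - i))) = (x + y) ^ n / fact n" for n
  proof -
    have "(x + y) ^ n / fact n = (\<Sum>i\<le>n. of_nat (n choose i) * x ^ i * y ^ (n - i) / fact n)"
      by (simp add: binomial_ring sum_divide_distrib)
    also have "\<dots> = (\<Sum>i\<le>n. x ^ i / fact i * (y ^ (n - i) / fact (n - i)))"
      by (intro sum.cong) (simp_all add: binomial_fact)
    finally show ?thesis ..
  qed
  ultimately have "(\<lambda>n. (x + y) ^ n / fact n) sums (padic_exp x * padic_exp y)"
    by simp
  then show ?thesis
    using padic_exp_sums[OF exp_domain_add[OF assms]] sums_unique2 by blast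
qed

lemma padic_exp_0: "padic_exp (0 :: 'a) = 1"
proof -
  have "(\<lambda>n. 0 ^ n / fact n :: 'a) sums (\<Sum>n\<in>{0}. 0 ^ n / fact n)"
    by (rule sums_finite) auto
  then show ?thesis
    by (simp add: padic_exp_def sums_unique[symmetric])
qed

lemma exp_domain_of_int_mult: "x \<in> exp_domain \<Longrightarrow> of_int m * x \<in> exp_domain"
  using mult_left_le_one_le[of "vabs x" "vabs (of_int m :: 'a)"] vabs_of_int_le_1[of m]
  by (auto simp: exp_domain_def vabs_mult)

lemma padic_exp_of_nat_mult: "x \<in> exp_domain \<Longrightarrow> padic_exp (of_nat n * x) = padic_exp x ^ n"
proof (induction n)
  case (Suc n)
  then show ?case
    using padic_exp_add[of x "of_nat n * x"] exp_domain_of_int_mult[of x "int n"]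
    by (simp add: algebra_simps)
qed (simp add: padic_exp_0)

lemma padic_exp_nonzero:
  assumes "x \<in> exp_domain"
  shows "padic_exp x \<noteq> 0"
  using padic_exp_add[of x "- x"] exp_domain_of_int_mult[OF assms, of "- 1"] assms
  by (auto simp: padic_exp_0)

lemma p_tilde_in_exp_domain: "(of_nat (p_tilde p) :: 'a) \<in> exp_domain"
proof -
  define e :: nat where "e = (if p = 2 then 2 else 1)"
  have "int p ^ e = int (p_tilde p)"
    by (simp add: e_def p_tilde_def)
  then have "vabs (of_int (int (p_tilde p)) :: 'a) \<le> (1 / real p) ^ e"
    by (intro vabs_of_int_le) (simp only: dvd_refl)
  then have "vabs (of_nat (p_tilde p) :: 'a) \<le> exp_ratio ^ (2 * e)"
    by (simp add: power_mult exp_ratio(3))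
  then show ?thesis
    by (simp add: exp_domain_def e_def split: if_splits)
qed

subsection \<open>The function \<open>\<gamma>\<^sub>r\<close>\<close>

text \<open>At 0 the term \<open>x * \<phi> (x - 1)\<close> vanishes, so \<open>S_op \<phi>\<close>
  determines \<open>\<phi> 0\<close> and then, recursively, \<open>\<phi>\<close> at every natural
  number. Density of the naturals and continuity do the rest.\<close>

lemma inj_on_S_op: "inj_on S_op (C_Zp :: ('a \<Rightarrow> 'a) set)"
proof (rule inj_onI)
  fix \<phi> \<psi> :: "'a \<Rightarrow> 'a"
  assume \<phi>: "\<phi> \<in> C_Zp" and \<psi>: "\<psi> \<in> C_Zp" and eq: "S_op \<phi> = S_op \<psi>"
  have S: "\<phi> x - x * \<phi> (x - 1) = \<psi> x - x * \<psi> (x - 1)" if "x \<in> Zp" for x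
    using fun_cong[OF eq, of x] that by (simp add: S_op_def)
  have nat: "\<phi> (of_nat n) = \<psi> (of_nat n)" for n
  proof (induction n)
    case 0
    show ?case
      using S[of 0] of_nat_in_Zp[of 0] by simp
  next
    case (Suc n)
    then show ?case
      using S[of "of_nat (Suc n)"] of_nat_in_Zp[of "Suc n"] by simp
  qed
  show "\<phi> = \<psi>"
  proof (rule extensionalityI[of _ Zp])
    fix x :: 'a
    assume x: "x \<in> Zp"
    then have "x \<in> closure \<nat>"
      using Zp_subset_closure_Nats by blast
    then obtain X where X: "\<And>n. X n \<in> \<nat>" "X \<longlonglongrightarrow> x"
      unfolding closure_sequential by blast
    have lim: "(\<lambda>n. f (X n)) \<longlonglongrightarrow> f x" if "f \<in> C_Zp" for f :: "'a \<Rightarrow> 'a"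
    proof (rule continuous_on_tendsto_compose[OF _ X(2) x])
      show "continuous_on Zp f"
        using that by (simp add: C_Zp_def)
      show "\<forall>\<^sub>F n in sequentially. X n \<in> Zp"
        using X(1) Nats_subset_Zp by (intro always_eventually) blast
    qed
    have "\<phi> (X n) = \<psi> (X n)" for n
    proof -
      obtain k where "X n = of_nat k"
        using X(1) by (rule Nats_cases)
      then show ?thesis
        by (simp add: nat)
    qed
    then show "\<phi> x = \<psi> x"
      using LIMSEQ_unique[OF lim[OF \<phi>]] lim[OF \<psi>] by simp
  qed (use \<phi> \<psi> in \<open>auto simp: C_Zp_def\<close>)
qed

lemma g_fun_of_nat: "g_fun r (of_nat n) = (r :: 'a) ^ n"
proof -
  have "g_fun r (of_nat n) = (\<Sum>k. (r - 1) ^ k * of_nat (n choose k))"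
    by (simp add: g_fun_def binomial_gbinomial)
  also have "\<dots> = (\<Sum>k\<le>n. (r - 1) ^ k * of_nat (n choose k))"
    by (rule suminf_finite) (auto simp: binomial_eq_0)
  also have "\<dots> = ((r - 1) + 1) ^ n"
    unfolding binomial_ring by (simp add: mult.commute)
  finally show ?thesis by simp
qed

context
  fixes r :: 'a
  assumes r: "vabs (r - 1) \<le> 1 / real p"
begin

text \<open>Since \<open>x (x - 1)\<^sub>n = (x)\<^sub>n\<^sub>+\<^sub>1\<close>, the equation \<open>S \<phi> = g\<^sub>r\<close> for a series \<open>\<phi> = \<Sum> c\<^sub>n (x)\<^sub>n\<close> says
  that \<open>c\<^sub>n - c\<^sub>n\<^sub>-\<^sub>1 = (r - 1)\<^sup>n / n!\<close>.\<close>

definition \<gamma>_coeff :: "nat \<Rightarrow> 'a" where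
  "\<gamma>_coeff n = (\<Sum>k\<le>n. (r - 1) ^ k / fact k)"

lemma vabs_\<gamma>_coeff_le_1: "vabs (\<gamma>_coeff n) \<le> 1"
  unfolding \<gamma>_coeff_def by (intro vabs_sum_le vabs_power_div_fact_le_1 r) simp

lemma falling_series_\<gamma>_coeff:
  assumes x: "x \<in> Zp"
  shows "falling_series \<gamma>_coeff x - x * falling_series \<gamma>_coeff (x - 1) = g_fun r x"
proof -
  let ?F = "falling_series \<gamma>_coeff"
  \<comment> \<open>The second sum is one term shorter because multiplication by \<open>x\<close>
    lengthens the falling factorial of \<open>x - 1\<close> by one factor. The identity is thus
    exact for every \<open>N\<close>, and it also yields convergence of the series for
    \<open>g_fun\<close>.\<close>
  have partial: "(\<Sum>n<N. (r - 1) ^ n * (x gchoose n)) =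
      (\<Sum>n<N. \<gamma>_coeff n * falling_fact x n)
        - x * (\<Sum>n<N - 1. \<gamma>_coeff n * falling_fact (x - 1) n)" for N
  proof (induction N)
    case (Suc N)
    show ?case
    proof (cases N)
      case 0
      then show ?thesis by (simp add: \<gamma>_coeff_def)
    next
      case (Suc M)
      have "(r - 1) ^ N * (x gchoose N) = (\<gamma>_coeff N - \<gamma>_coeff M) * falling_fact x N"
        by (simp add: gbinomial_falling_fact \<gamma>_coeff_def Suc)
      then have "(\<Sum>n<Suc N. (r - 1) ^ n * (x gchoose n)) =
          (\<Sum>n<N. \<gamma>_coeff n * falling_fact x n) + \<gamma>_coeff N * falling_fact x N -
          (x * (\<Sum>n<M. \<gamma>_coeff n * falling_fact (x - 1) n) + \<gamma>_coeff M * falling_fact x N)"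
        using Suc.IH Suc by (simp add: left_diff_distrib)
      also have "x * (\<Sum>n<M. \<gamma>_coeff n * falling_fact (x - 1) n) + \<gamma>_coeff M * falling_fact x N
          = x * (\<Sum>n<N. \<gamma>_coeff n * falling_fact (x - 1) n)"
        by (simp add: Suc falling_fact_Suc_shift algebra_simps)
      finally show ?thesis
        by simp
    qed
  qed simp
  have "(\<lambda>N. \<Sum>n<N. \<gamma>_coeff n * falling_fact x n) \<longlonglongrightarrow> ?F x"
    using falling_series_sums_Zp[of \<gamma>_coeff, OF vabs_\<gamma>_coeff_le_1 x] by (simp add: sums_def)
  moreover have "(\<lambda>N. \<Sum>n<N. \<gamma>_coeff n * falling_fact (x - 1) n) \<longlonglongrightarrow> ?F (x - 1)"
    using falling_series_sums_Zp[of \<gamma>_coeff, OF vabs_\<gamma>_coeff_le_1 Zp_diff_1[OF x]] by (simp add: sums_def)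
  then have "(\<lambda>N. \<Sum>n<N - 1. \<gamma>_coeff n * falling_fact (x - 1) n) \<longlonglongrightarrow> ?F (x - 1)"
    using LIMSEQ_imp_Suc[of "\<lambda>N. \<Sum>n<N - 1. \<gamma>_coeff n * falling_fact (x - 1) n"] by simp
  ultimately have "(\<lambda>N. \<Sum>n<N. (r - 1) ^ n * (x gchoose n)) \<longlonglongrightarrow> ?F x - x * ?F (x - 1)"
    unfolding partial by (intro tendsto_diff_ultra tendsto_mult_left_ultra)
  then have "(\<lambda>n. (r - 1) ^ n * (x gchoose n)) sums (?F x - x * ?F (x - 1))"
    by (simp add: sums_def)
  then show ?thesis
    using x sums_unique by (force simp: g_fun_def)
qed

lemma restrict_falling_series_in_C_Zp: "restrict (falling_series \<gamma>_coeff) Zp \<in> C_Zp"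
  using continuous_on_falling_series[of \<gamma>_coeff, OF vabs_\<gamma>_coeff_le_1]
  by (simp add: C_Zp_def cong: continuous_on_cong)

lemma S_op_restrict_falling_series: "S_op (restrict (falling_series \<gamma>_coeff) Zp) = g_fun r"
proof (rule extensionalityI[of _ Zp])
  show "S_op (restrict (falling_series \<gamma>_coeff) Zp) x = g_fun r x" if "x \<in> Zp" for x
    using that Zp_diff_1[OF that] falling_series_\<gamma>_coeff[OF that] by (simp add: S_op_def)
qed (simp_all add: S_op_def g_fun_def)

text \<open>\<open>inv_into\<close> chooses some preimage; injectivity of \<open>S_op\<close> on
  \<open>C_Zp\<close> forces it to be the explicit series.\<close>

lemma \<gamma>_fun_eq: "\<gamma>_fun r = restrict (falling_series \<gamma>_coeff) Zp"
  unfolding \<gamma>_fun_def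
  by (rule inv_into_f_eq[of S_op, OF inj_on_S_op restrict_falling_series_in_C_Zp
        S_op_restrict_falling_series])

lemma \<gamma>_fun_of_nat: "\<gamma>_fun r (of_nat n) = gamma_poly n r"
proof -
  have S: "\<gamma>_fun r x - x * \<gamma>_fun r (x - 1) = g_fun r x" if "x \<in> Zp" for x
    using fun_cong[OF S_op_restrict_falling_series, of x] that by (simp add: \<gamma>_fun_eq S_op_def)
  show ?thesis
  proof (induction n)
    case 0
    show ?case
      using S[of "of_nat 0"] by (simp only: of_nat_in_Zp g_fun_of_nat) simp
  next
    case (Suc n)
    have "\<gamma>_fun r (of_nat (Suc n)) - of_nat (Suc n) * \<gamma>_fun r (of_nat n) = r ^ Suc n"
      using S[of "of_nat (Suc n)"] by (simp only: of_nat_in_Zp g_fun_of_nat) simp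
    then show ?case
      by (simp add: Suc algebra_simps)
  qed
qed

lemma locally_analytic_\<gamma>_bar: "locally_analytic (\<gamma>_bar p r)"
  unfolding locally_analytic_def
proof
  fix x :: 'a
  assume x: "x \<in> Zp"
  then have "x - 1 \<in> Zp"
    by (rule Zp_diff_1)
  \<comment> \<open>The expansion is taken about \<open>x - 1\<close> because
    \<open>\<gamma>_bar\<close> shifts its argument; the displacement
    \<open>(y - 1) - (x - 1)\<close> is again \<open>y - x\<close>.\<close>
  then obtain a where a: "\<And>y. vabs (y - (x - 1)) \<le> 1 / real p \<Longrightarrow>
      (\<lambda>k. a k * (y - (x - 1)) ^ k) sums falling_series \<gamma>_coeff y"
    using falling_series_power_series[of \<gamma>_coeff, OF vabs_\<gamma>_coeff_le_1] by blast
  define E where "E = padic_exp (r * of_nat (p_tilde p))"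
  have "(\<lambda>k. (E * a k) * (y - x) ^ k) sums \<gamma>_bar p r y"
    if "y \<in> ball x (1 / real p) \<inter> Zp" for y
  proof -
    have y: "y \<in> Zp" "y - 1 \<in> Zp" "vabs (y - x) \<le> 1 / real p"
      using that Zp_diff_1 by (auto simp: dist_eq_vabs vabs_minus_commute)
    then have "(\<lambda>k. a k * (y - x) ^ k) sums falling_series \<gamma>_coeff (y - 1)"
      using a[of "y - 1"] by simp
    then have "(\<lambda>k. E * (a k * (y - x) ^ k)) sums (E * falling_series \<gamma>_coeff (y - 1))"
      by (rule sums_mult_ultra)
    then show ?thesis
      using y by (simp add: \<gamma>_bar_def \<gamma>_fun_eq E_def mult.assoc)
  qed
  then show "\<exists>U a. open U \<and> x \<in> U \<and>
      (\<forall>y\<in>U \<inter> Zp. (\<lambda>n. a n * (y - x) ^ n) sums \<gamma>_bar p r y)"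
    using inverse_p(1)
    by (intro exI[of _ "ball x (1 / real p)"] exI[of _ "\<lambda>k. E * a k"]) auto
qed

lemma \<gamma>_bar_of_nat_Suc:
  "\<gamma>_bar p r (of_nat (Suc n)) = padic_exp (r * of_nat (p_tilde p)) * gamma_poly n r"
proof -
  have "\<gamma>_bar p r (of_nat (Suc n)) =
      padic_exp (r * of_nat (p_tilde p)) * \<gamma>_fun r (of_nat (Suc n) - 1)"
    unfolding \<gamma>_bar_def using of_nat_in_Zp by (rule restrict_apply')
  then show ?thesis
    by (simp add: \<gamma>_fun_of_nat)
qed

end

end

section \<open>The homomorphism on \<open>\<rat>(e)\<close>\<close>

lemma is_subfield_Q_e: "is_subfield Q_e"
  unfolding is_subfield_def Q_e_def by blast

context
  fixes x y :: real
  assumes x: "x \<in> Q_e" and y: "y \<in> Q_e"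
begin

lemma Q_e_diff: "x - y \<in> Q_e" and Q_e_mult: "x * y \<in> Q_e" and Q_e_inverse: "inverse x \<in> Q_e"
  using is_subfield_Q_e x y unfolding is_subfield_def by blast+

end

lemma Q_e_1: "1 \<in> Q_e"
  using is_subfield_Q_e by (simp add: is_subfield_def)

lemma Q_e_0: "0 \<in> Q_e"
  using Q_e_diff[OF Q_e_1 Q_e_1] by simp

lemma Q_e_add: "x \<in> Q_e \<Longrightarrow> y \<in> Q_e \<Longrightarrow> x + y \<in> Q_e"
  using Q_e_diff[of x "0 - y"] Q_e_diff[OF Q_e_0, of y] by simp

lemma Q_e_power: "x \<in> Q_e \<Longrightarrow> x ^ n \<in> Q_e"
  by (induction n) (simp_all add: Q_e_1 Q_e_mult)

lemma Q_e_of_nat: "of_nat n \<in> Q_e"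
  by (induction n) (simp_all add: Q_e_0 Q_e_1 Q_e_add)

lemma Q_e_of_int: "of_int m \<in> Q_e"
  by (cases m rule: int_diff_cases) (simp add: Q_e_diff Q_e_of_nat)

lemma Q_e_exp_minus_1: "exp (- 1) \<in> Q_e"
proof -
  have "exp 1 \<in> Q_e"
    by (auto simp: Q_e_def)
  then show ?thesis
    using Q_e_inverse[of "exp 1"] by (simp add: exp_minus)
qed

text \<open>A possibly negative power of \<open>exp (- 1)\<close> expressed through two natural
  powers, in a multiplied-out form to which a homomorphism can be applied directly.\<close>

lemma exp_minus_of_int_diff:
  "exp (- real_of_int (int a - int b)) * exp (- 1) ^ b = exp (- 1) ^ a"
  by (simp flip: exp_of_nat_mult exp_add)

lemma Q_e_exp_minus_of_int: "exp (- real_of_int m) \<in> Q_e"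
proof -
  obtain a b where m: "m = int a - int b"
    by (rule int_diff_cases)
  have "exp (- real_of_int m) = exp (- 1) ^ a * inverse (exp (- 1) ^ b)"
    using exp_minus_of_int_diff[of a b] by (simp add: m field_simps)
  also have "\<dots> \<in> Q_e"
    by (intro Q_e_mult Q_e_inverse[of _ 1] Q_e_power Q_e_exp_minus_1 Q_e_1)
  finally show ?thesis .
qed

context
  fixes p :: nat and \<tau> :: "real \<Rightarrow> 'a :: {field_char_0, metric_space}"
  assumes \<tau>: "is_\<tau> p \<tau>"
begin

lemma \<tau>_add: "x \<in> Q_e \<Longrightarrow> y \<in> Q_e \<Longrightarrow> \<tau> (x + y) = \<tau> x + \<tau> y"
  and \<tau>_mult: "x \<in> Q_e \<Longrightarrow> y \<in> Q_e \<Longrightarrow> \<tau> (x * y) = \<tau> x * \<tau> y"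
  and \<tau>_1: "\<tau> 1 = 1"
  and \<tau>_exp_minus_1: "\<tau> (exp (- 1)) = padic_exp (of_nat (p_tilde p))"
  using \<tau> by (auto simp: is_\<tau>_def)

lemma \<tau>_0: "\<tau> 0 = 0"
  using \<tau>_add[OF Q_e_0 Q_e_0] by simp

lemma \<tau>_power: "x \<in> Q_e \<Longrightarrow> \<tau> (x ^ n) = \<tau> x ^ n"
  by (induction n) (simp_all add: \<tau>_1 \<tau>_mult Q_e_power)

lemma \<tau>_of_nat: "\<tau> (of_nat n) = of_nat n"
  by (induction n) (simp_all add: \<tau>_0 \<tau>_1 \<tau>_add Q_e_1 Q_e_of_nat)

lemma \<tau>_of_int: "\<tau> (of_int m) = of_int m"
proof -
  obtain a b where m: "m = int a - int b"
    by (rule int_diff_cases)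
  then have "\<tau> (of_int m) + \<tau> (of_nat b) = \<tau> (of_nat a)"
    by (simp flip: \<tau>_add add: Q_e_diff Q_e_of_nat)
  then show ?thesis
    by (simp add: \<tau>_of_nat m algebra_simps)
qed

end

text \<open>With \<open>m = a - b\<close> and \<open>t = p_tilde p\<close>, both sides become
  \<open>padic_exp t ^ a\<close> after multiplication by \<open>padic_exp t ^ b\<close>, which is
  nonzero and can be cancelled.\<close>

lemma (in padic_field) \<tau>_exp_minus_of_int:
  fixes \<tau> :: "real \<Rightarrow> 'a"
  assumes "is_\<tau> p \<tau>"
  shows "\<tau> (exp (- real_of_int m)) = padic_exp (of_int m * of_nat (p_tilde p))"
proof -
  define t :: 'a where "t = of_nat (p_tilde p)"
  have t: "t \<in> exp_domain"
    unfolding t_def by (rule p_tilde_in_exp_domain)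
  obtain a b where m: "m = int a - int b"
    by (rule int_diff_cases)
  have "\<tau> (exp (- real_of_int m)) * padic_exp t ^ b
      = \<tau> (exp (- real_of_int m) * exp (- 1) ^ b)"
    by (simp add: \<tau>_mult[OF assms] \<tau>_power[OF assms] \<tau>_exp_minus_1[OF assms]
        Q_e_exp_minus_of_int Q_e_power Q_e_exp_minus_1 t_def)
  also have "\<dots> = padic_exp t ^ a"
    unfolding m exp_minus_of_int_diff
    by (simp add: \<tau>_power[OF assms] \<tau>_exp_minus_1[OF assms] Q_e_exp_minus_1 t_def)
  also have "\<dots> = padic_exp (of_int m * t + of_nat b * t)"
    using padic_exp_of_nat_mult[OF t, of a] by (simp add: m algebra_simps)
  also have "\<dots> = padic_exp (of_int m * t) * padic_exp t ^ b"
    using t exp_domain_of_int_mult[OF t, of "int b"]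
    by (subst padic_exp_add) (simp_all add: exp_domain_of_int_mult padic_exp_of_nat_mult)
  finally show ?thesis
    using padic_exp_nonzero[OF t] by (simp add: t_def)
qed

lemma is_Cp_imp_padic_field:
  assumes "prime p" "is_Cp p TYPE('a :: {field_char_0, complete_space})"
  shows "padic_field TYPE('a) p"
proof -
  have dist: "\<forall>x y :: 'a. dist x y = vabs (x - y)"
    and mult: "\<forall>x y :: 'a. vabs (x * y) = vabs x * vabs y"
    and add: "\<forall>x y :: 'a. vabs (x + y) \<le> max (vabs x) (vabs y)"
    and of_int: "\<forall>m :: int. m \<noteq> 0 \<longrightarrow>
      vabs (of_int m :: 'a) = 1 / real p ^ multiplicity (int p) m"
    using assms(2) unfolding is_Cp_def by - (elim conjE, assumption)+
  show ?thesis
    by unfold_locales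
      (rule dist[rule_format] mult[rule_format] add[rule_format] assms(1)
        of_int[rule_format]; assumption)+
qed

theorem mainTheorem3:
  fixes p :: nat and r :: int
  assumes "prime p"
    and "is_Cp p TYPE('a :: {field_char_0, complete_space})"
    and "[r = 1] (mod int p)"
  shows "locally_analytic (\<gamma>_bar p (of_int r :: 'a)) \<and>
    (\<forall>\<tau> :: real \<Rightarrow> 'a. is_\<tau> p \<tau> \<longrightarrow>
      (\<forall>n\<ge>1. \<gamma>_bar p (of_int r) (of_nat n) = \<tau> (inc_Gamma n (real_of_int r))))"
proof -
  interpret padic_field "TYPE('a)" p
    using assms(1,2) by (rule is_Cp_imp_padic_field)
  have "int p ^ 1 dvd r - 1"
    using assms(3) by (simp add: cong_iff_dvd_diff)
  then have r: "vabs (of_int r - 1 :: 'a) \<le> 1 / real p"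
    using vabs_of_int_le[of 1 "r - 1"] by simp
  have "\<gamma>_bar p (of_int r) (of_nat n) = \<tau> (inc_Gamma n (real_of_int r))"
    if \<tau>: "is_\<tau> p \<tau>" and "n \<ge> 1" for \<tau> :: "real \<Rightarrow> 'a" and n
  proof -
    obtain m where n: "n = Suc m"
      using \<open>n \<ge> 1\<close> by (cases n) auto
    \<comment> \<open>The polynomial is evaluated in the integers, where \<open>\<tau>\<close> is
      known to act as the canonical embedding; only the exponential factor is changed by
      \<open>\<tau>\<close>.\<close>
    have "\<tau> (inc_Gamma n (real_of_int r)) = \<tau> (exp (- real_of_int r) * of_int (gamma_poly m r))"
      by (simp add: n inc_Gamma_Suc of_int_gamma_poly)
    also have "\<dots> = \<tau> (exp (- real_of_int r)) * \<tau> (of_int (gamma_poly m r))"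
      by (rule \<tau>_mult[OF \<tau> Q_e_exp_minus_of_int Q_e_of_int])
    also have "\<dots> = padic_exp (of_int r * of_nat (p_tilde p)) * of_int (gamma_poly m r)"
      by (simp only: \<tau>_of_int[OF \<tau>] \<tau>_exp_minus_of_int[OF \<tau>])
    finally show ?thesis
      using \<gamma>_bar_of_nat_Suc[OF r, of m] by (simp only: n of_int_gamma_poly)
  qed
  then show ?thesis
    using locally_analytic_\<gamma>_bar[OF r] by blast
qed

end
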